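(* Let $G$ and $F$ be two vertex-transitive graphs (locally finite, simple and connected) and let $\phi$ be a non-trivial connection on $G$ with values in $\mathrm{Aut}(F)$. Then the graph bundle $G\times_\phi F$ is not isomorphic (as a graph) to the Cartesian product $G\times F$. Moreover, if $G\times_\phi F$ is a discrete vector bundle, then $G\times_\phi F$ is not vertex-transitive.
   Context: Graph bundle: Let $G=(V_G,E_G)$ and $F=(V_F,E_F)$ be locally finite, simple, connected graphs and let $E_G^{or}=\{(x,y): x,y\in V_G,\ x\sim y\}$ be the set of oriented edges of $G$. A connection is a map $\phi:E_G^{or}\to \mathrm{Aut}(F)$, $(x,y)\mapsto\phi_{yx}$, into the group of graph automorphisms of $F$, such that $\phi_{xy}=\phi_{yx}^{-1}$. The graph bundle $G\times_\phi F$ is the graph with vertex set $V_G\times V_F$ in which $(x,v)\sim(y,w)$ if and only if either (i) $x=y$ and $v\sim w$ in $F$, or (ii) $x\sim y$ in $G$ and $w=\phi_{yx}(v)$. Let $\pi:V_G\times V_F\to V_G$ be the projection to the first factor. Equivalence and triviality: Two connections $\phi_1,\phi_2$ (for the same $G$ and $F$) are equivalent if there exists a graph isomorphism $\varphi$ from $G\times_{\phi_1}F$ to $G\times_{\phi_2}F$ with $\pi\circ\varphi=\pi$. The connection assigning the identity of $\mathrm{Aut}(F)$ to each oriented edge yields the Cartesian product $G\times F$; any connection equivalent to it is called trivial, and a connection is non-trivial if it is not trivial. Discrete vector bundle: $G\times_\phi F$ is a discrete vector bundle if there exists a vertex $o\in V_F$ (the null element) such that $\phi_{yx}(o)=o$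 for every $(x,y)\in E_G^{or}$. Vertex-transitive: a graph is vertex-transitive if for any pair of its vertices there is an automorphism of the graph mapping one to the other. *)

theory Defs
  imports "Graph_Theory.Graph_Theory"
begin

text \<open>
  Simple graphs, possibly infinite, are symmetric loop-free digraphs whose arcs are ordered pairs of
  vertices (locale \<^locale>\<open>pair_bidirected_digraph\<close>). Hence \<^term>\<open>parcs G\<close> is at once the
  adjacency relation and the set of oriented edges, and \<^const>\<open>Digraph_Component.connected\<close>
  (which includes non-emptiness) is ordinary connectedness. Maps between vertex sets are total functions of which
  only the values on the vertex set matter.
\<close>

definition locally_finite :: "'a pair_pre_digraph \<Rightarrow> bool" where
  "locally_finite G \<longleftrightarrow> (\<forall>x\<in>pverts G. finite (out_arcs (with_proj G) x))"

definition graph_isomorphism ::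
    "'a pair_pre_digraph \<Rightarrow> 'b pair_pre_digraph \<Rightarrow> ('a \<Rightarrow> 'b) \<Rightarrow> bool" where
  "graph_isomorphism G H f \<longleftrightarrow>
     bij_betw f (pverts G) (pverts H) \<and>
     (\<forall>u\<in>pverts G. \<forall>v\<in>pverts G. (u, v) \<in> parcs G \<longleftrightarrow> (f u, f v) \<in> parcs H)"

text \<open>
  The existence of such a vertex map is the isomorphism relation \<^const>\<open>digraph_iso\<close>, which is
  formulated with separate maps on vertices and on arcs.
\<close>

lemma digraph_iso_iff_graph_isomorphism:
  assumes G: "pair_wf_digraph G" and H: "pair_wf_digraph H"
  shows "digraph_iso (with_proj G) (with_proj H) \<longleftrightarrow> (\<exists>f. graph_isomorphism G H f)"
proof -
  interpret G: pair_wf_digraph G by fact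
  interpret H: pair_wf_digraph H by fact
  show ?thesis
  proof
    assume "digraph_iso (with_proj G) (with_proj H)"
    then obtain h where h: "pre_digraph.digraph_isomorphism (with_proj G) h"
        and eq: "with_proj H = app_iso h (with_proj G)"
      unfolding digraph_iso_def by blast
    have vs: "pverts H = iso_verts h ` pverts G" and as: "parcs H = iso_arcs h ` parcs G"
      and tl: "iso_tail h = fst" and hd: "iso_head h = snd"
      using eq by (auto simp: with_proj_def app_iso_def)
    have inj: "inj_on (iso_verts h) (pverts G)"
      and ends: "\<And>a. a \<in> parcs G \<Longrightarrow> iso_arcs h a = (iso_verts h (fst a), iso_verts h (snd a))"
      using h tl hd by (auto simp: pre_digraph.digraph_isomorphism_def prod_eq_iff)
    have "(u, v) \<in> parcs G \<longleftrightarrow> (iso_verts h u, iso_verts h v) \<in> parcs H"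
      if uv: "u \<in> pverts G" "v \<in> pverts G" for u v
    proof
      assume "(u, v) \<in> parcs G"
      then show "(iso_verts h u, iso_verts h v) \<in> parcs H"
        using as ends by (metis fst_conv image_eqI snd_conv)
    next
      assume "(iso_verts h u, iso_verts h v) \<in> parcs H"
      then obtain a where a: "a \<in> parcs G" "iso_arcs h a = (iso_verts h u, iso_verts h v)"
        using as by auto
      moreover have "fst a \<in> pverts G" "snd a \<in> pverts G"
        using a(1) G.arc_fst_in_verts G.arc_snd_in_verts by blast+
      ultimately have "fst a = u" "snd a = v"
        using ends[OF a(1)] uv inj_onD[OF inj] by auto
      then show "(u, v) \<in> parcs G" using a by (metis prod.collapse)
    qed
    then have "graph_isomorphism G H (iso_verts h)"
      using inj vs by (auto simp: graph_isomorphism_def bij_betw_def)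
    then show "\<exists>f. graph_isomorphism G H f" by blast
  next
    assume "\<exists>f. graph_isomorphism G H f"
    then obtain f where f: "graph_isomorphism G H f" by blast
    define h where "h = \<lparr>iso_verts = f, iso_arcs = map_prod f f, iso_head = snd, iso_tail = fst\<rparr>"
    have inj: "inj_on f (pverts G)" and im: "f ` pverts G = pverts H"
      and e: "\<And>u v. u \<in> pverts G \<Longrightarrow> v \<in> pverts G \<Longrightarrow> (u, v) \<in> parcs G \<longleftrightarrow> (f u, f v) \<in> parcs H"
      using f by (auto simp: graph_isomorphism_def bij_betw_def)
    have inj_arcs: "inj_on (map_prod f f) (parcs G)"
      by (rule inj_on_subset[OF map_prod_inj_on[OF inj inj]]) (auto dest: G.wellformed')
    have "map_prod f f ` parcs G = parcs H"
    proof (intro equalityI subsetI)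
      fix p assume "p \<in> map_prod f f ` parcs G"
      then show "p \<in> parcs H" using e by (auto dest: G.wellformed')
    next
      fix p assume p: "p \<in> parcs H"
      then obtain u v where "u \<in> pverts G" "v \<in> pverts G" "p = (f u, f v)"
        using im H.wellformed' by (metis imageE prod.collapse)
      then show "p \<in> map_prod f f ` parcs G" using p e by force
    qed
    then have "with_proj H = app_iso h (with_proj G)"
      using im by (auto simp: with_proj_def app_iso_def h_def)
    moreover have "pre_digraph.digraph_isomorphism (with_proj G) h"
      using inj inj_arcs G.wf_digraph by (auto simp: pre_digraph.digraph_isomorphism_def h_def)
    ultimately show "digraph_iso (with_proj G) (with_proj H)"
      unfolding digraph_iso_def by blast
  qed
qed

definition graph_automorphism :: "'a pair_pre_digraph \<Rightarrow> ('a \<Rightarrow> 'a) \<Rightarrow> bool" where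
  "graph_automorphism G f \<longleftrightarrow> graph_isomorphism G G f"

definition vertex_transitive :: "'a pair_pre_digraph \<Rightarrow> bool" where
  "vertex_transitive G \<longleftrightarrow>
     (\<forall>u\<in>pverts G. \<forall>v\<in>pverts G. \<exists>f. graph_automorphism G f \<and> f u = v)"

text \<open>
  The index order is that of \<open>\<phi>\<^sub>y\<^sub>x\<close>: for an oriented edge \<open>(x, y)\<close>, the automorphism \<^term>\<open>\<phi> y x\<close>
  carries the fibre over \<open>x\<close> to the fibre over \<open>y\<close>.
\<close>

definition is_connection ::
    "'a pair_pre_digraph \<Rightarrow> 'b pair_pre_digraph \<Rightarrow> ('a \<Rightarrow> 'a \<Rightarrow> 'b \<Rightarrow> 'b) \<Rightarrow> bool" where
  "is_connection G F \<phi> \<longleftrightarrow>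
     (\<forall>(x, y)\<in>parcs G. graph_automorphism F (\<phi> y x) \<and>
        (\<forall>v\<in>pverts F. \<phi> x y v = the_inv_into (pverts F) (\<phi> y x) v))"

definition graph_bundle ::
    "'a pair_pre_digraph \<Rightarrow> ('a \<Rightarrow> 'a \<Rightarrow> 'b \<Rightarrow> 'b) \<Rightarrow> 'b pair_pre_digraph
      \<Rightarrow> ('a \<times> 'b) pair_pre_digraph" where
  "graph_bundle G \<phi> F =
     \<lparr> pverts = pverts G \<times> pverts F,
       parcs = {((x, v), (y, w)). x \<in> pverts G \<and> y \<in> pverts G \<and> v \<in> pverts F \<and> w \<in> pverts F \<and>
                  (x = y \<and> (v, w) \<in> parcs F \<or> (x, y) \<in> parcs G \<and> w = \<phi> y x v)} \<rparr>"

definition cartesian_product ::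
    "'a pair_pre_digraph \<Rightarrow> 'b pair_pre_digraph \<Rightarrow> ('a \<times> 'b) pair_pre_digraph" where
  "cartesian_product G F =
     \<lparr> pverts = pverts G \<times> pverts F,
       parcs = {((x, v), (y, w)). x \<in> pverts G \<and> y \<in> pverts G \<and> v \<in> pverts F \<and> w \<in> pverts F \<and>
                  (x = y \<and> (v, w) \<in> parcs F \<or> (x, y) \<in> parcs G \<and> v = w)} \<rparr>"

definition identity_connection :: "'a \<Rightarrow> 'a \<Rightarrow> 'b \<Rightarrow> 'b" where
  "identity_connection y x = id"

lemma graph_bundle_identity_connection:
  "graph_bundle G identity_connection F = cartesian_product G F"
  by (auto simp: graph_bundle_def cartesian_product_def identity_connection_def)

definition equivalent_connections ::
    "'a pair_pre_digraph \<Rightarrow> 'b pair_pre_digraph \<Rightarrow> ('a \<Rightarrow> 'a \<Rightarrow> 'b \<Rightarrow> 'b)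
      \<Rightarrow> ('a \<Rightarrow> 'a \<Rightarrow> 'b \<Rightarrow> 'b) \<Rightarrow> bool" where
  "equivalent_connections G F \<phi>1 \<phi>2 \<longleftrightarrow>
     (\<exists>f. graph_isomorphism (graph_bundle G \<phi>1 F) (graph_bundle G \<phi>2 F) f \<and>
          (\<forall>p\<in>pverts G \<times> pverts F. fst (f p) = fst p))"

definition trivial_connection ::
    "'a pair_pre_digraph \<Rightarrow> 'b pair_pre_digraph \<Rightarrow> ('a \<Rightarrow> 'a \<Rightarrow> 'b \<Rightarrow> 'b) \<Rightarrow> bool" where
  "trivial_connection G F \<phi> \<longleftrightarrow> equivalent_connections G F \<phi> identity_connection"

definition discrete_vector_bundle ::
    "'a pair_pre_digraph \<Rightarrow> ('a \<Rightarrow> 'a \<Rightarrow> 'b \<Rightarrow> 'b) \<Rightarrow> 'b pair_pre_digraph \<Rightarrow> bool" where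
  "discrete_vector_bundle G \<phi> F \<longleftrightarrow>
     (\<exists>z\<in>pverts F. \<forall>(x, y)\<in>parcs G. \<phi> y x z = z)"

lemma pair_bidirected_digraph_graph_bundle:
  assumes G: "pair_bidirected_digraph G" and F: "pair_bidirected_digraph F"
    and \<phi>: "is_connection G F \<phi>"
  shows "pair_bidirected_digraph (graph_bundle G \<phi> F)"
proof -
  interpret G: pair_bidirected_digraph G by fact
  interpret F: pair_bidirected_digraph F by fact
  have sG: "(x, y) \<in> parcs G \<Longrightarrow> (y, x) \<in> parcs G" for x y
    using G.pair_sym_arcs by (auto simp: symmetric_def dest: symD)
  have sF: "(x, y) \<in> parcs F \<Longrightarrow> (y, x) \<in> parcs F" for x y
    using F.pair_sym_arcs by (auto simp: symmetric_def dest: symD)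
  have inv: "\<phi> x y (\<phi> y x v) = v" if "(x, y) \<in> parcs G" "v \<in> pverts F" for x y v
  proof -
    have b: "bij_betw (\<phi> y x) (pverts F) (pverts F)"
      and i: "\<forall>v\<in>pverts F. \<phi> x y v = the_inv_into (pverts F) (\<phi> y x) v"
      using that \<phi> by (auto simp: is_connection_def graph_automorphism_def graph_isomorphism_def)
    have "\<phi> y x v \<in> pverts F" using b that by (auto dest: bij_betwE)
    then show ?thesis using b i that by (simp add: bij_betw_def the_inv_into_f_f)
  qed
  show ?thesis
  proof
    fix e assume "e \<in> parcs (graph_bundle G \<phi> F)"
    then show "fst e \<in> pverts (graph_bundle G \<phi> F)" "snd e \<in> pverts (graph_bundle G \<phi> F)"
        "fst e \<noteq> snd e"
      using G.pair_no_loops F.pair_no_loops by (fastforce simp: graph_bundle_def)+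
  next
    show "symmetric (with_proj (graph_bundle G \<phi> F))"
      using sG sF inv by (auto simp: symmetric_def graph_bundle_def intro!: symI)
  qed
qed

end

theory Submission
  imports Defs
begin

text \<open>
  The two graphs are told apart by counting closed walks. Parallel transport back to the fibre over
  the starting point turns a walk of length \<open>n\<close> in the bundle into a walk of length \<open>n\<close> in the
  Cartesian product with the same start and the same projection to the base
  (\<open>walk_from_straighten\<close>), and this is a bijection between the walks that start at
  \<open>(x, v)\<close>. It fails to match closed walks with closed walks only when the projection \<open>\<gamma>\<close> is a
  closed base walk whose holonomy moves the fibre coordinate.

  Suppose that the holonomy along some closed walk at \<open>x\<close> moves \<open>v\<close>, and let \<open>n\<close> be the least
  length of such a walk \<open>\<gamma>\<close>. A closed walk of length \<open>n\<close> at \<open>(x, v)\<close> in the bundle either contains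
  a vertical step, so that its base walk has fewer than \<open>n\<close> steps and fixes \<open>v\<close> by minimality, or it
  is the horizontal lift of its base walk, which then fixes \<open>v\<close> because the lift closes up. Hence
  every closed walk of length \<open>n\<close> at \<open>(x, v)\<close> in the bundle straightens to a closed walk in the
  product. The product has at least one more: \<open>\<gamma>\<close> with constant fibre coordinate \<open>v\<close>. By local finiteness
  the bundle therefore has strictly fewer closed walks of length \<open>n\<close> at \<open>(x, v)\<close> than the product
  (\<open>holonomy_deficit\<close>).

  A connection on a connected base whose holonomy around every closed walk at one base point is the
  identity is trivial, because transport to that point does not depend on the path and so defines a
  global straightening (\<open>trivial_connection_if_no_holonomy\<close>). So a non-trivial connection has a
  deficit at some \<open>(x, v)\<close>.

  The product is vertex-transitive, so the number of its closed walks of length \<open>n\<close> is the same at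
  all vertices. An isomorphism from the bundle would carry this number to \<open>(x, v)\<close>, contradicting the
  deficit. If the bundle has a null element \<open>z\<close>, all holonomies fix \<open>z\<close>, so bundle and product have
  equally many closed walks at \<open>(x, z)\<close> (\<open>card_closed_walks_null\<close>); the counts at \<open>(x, v)\<close> and
  \<open>(x, z)\<close> then differ in the bundle, which cannot be vertex-transitive.
\<close>

section \<open>Closed walks\<close>

text \<open>
  The starting vertex is kept apart from the list of the later vertices, so that the length of the
  list is the number of steps and the walk without steps is \<^term>\<open>[]\<close>.
\<close>

primrec walk_from :: "('v \<times> 'v) set \<Rightarrow> 'v \<Rightarrow> 'v list \<Rightarrow> bool" where
  "walk_from E p [] \<longleftrightarrow> True"
| "walk_from E p (q # qs) \<longleftrightarrow> (p, q) \<in> E \<and> walk_from E q qs"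

definition closed_walks :: "'v pair_pre_digraph \<Rightarrow> nat \<Rightarrow> 'v \<Rightarrow> 'v list set" where
  "closed_walks H n p = {ps. length ps = n \<and> walk_from (parcs H) p ps \<and> last (p # ps) = p}"

lemma walk_from_append:
  "walk_from E p (ps @ qs) \<longleftrightarrow> walk_from E p ps \<and> walk_from E (last (p # ps)) qs"
  by (induction ps arbitrary: p) auto

lemma walk_from_in_verts:
  assumes "pair_wf_digraph H" "walk_from (parcs H) p ps"
  shows "set ps \<subseteq> pverts H"
proof -
  interpret pair_wf_digraph H by fact
  show ?thesis using assms(2) by (induction ps arbitrary: p) (auto dest: arc_snd_in_verts)
qed

lemma finite_walks_from:
  assumes "\<And>p. finite (E `` {p})"
  shows "finite {ps. length ps = n \<and> walk_from E p ps}"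
proof (induction n arbitrary: p)
  case (Suc n)
  have "{ps. length ps = Suc n \<and> walk_from E p ps} \<subseteq>
      (\<Union>q\<in>E `` {p}. (#) q ` {ps. length ps = n \<and> walk_from E q ps})"
    by (auto simp: length_Suc_conv)
  then show ?case by (rule finite_subset) (use assms Suc in auto)
qed simp

lemma locally_finite_finite_neighbours:
  assumes "pair_wf_digraph H" "locally_finite H"
  shows "finite (parcs H `` {p})"
proof (cases "p \<in> pverts H")
  case True
  have "parcs H `` {p} \<subseteq> snd ` out_arcs (with_proj H) p"
    by (force simp: out_arcs_def)
  moreover have "finite (out_arcs (with_proj H) p)"
    using assms True by (simp add: locally_finite_def)
  ultimately show ?thesis by (blast intro: finite_subset)
next
  case False
  interpret pair_wf_digraph H by fact
  have "parcs H `` {p} = {}" using False by (auto dest: arc_fst_in_verts)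
  then show ?thesis by simp
qed

lemma card_closed_walks_isomorphism:
  assumes H: "pair_wf_digraph H" and K: "pair_wf_digraph K"
    and f: "graph_isomorphism H K f" and p: "p \<in> pverts H"
  shows "card (closed_walks H n p) = card (closed_walks K n (f p))"
proof -
  have inj: "inj_on f (pverts H)" and im: "f ` pverts H = pverts K"
    and e: "\<And>u v. u \<in> pverts H \<Longrightarrow> v \<in> pverts H \<Longrightarrow> (u, v) \<in> parcs H \<longleftrightarrow> (f u, f v) \<in> parcs K"
    using f by (auto simp: graph_isomorphism_def bij_betw_def)
  have walk: "walk_from (parcs K) (f q) (map f ps) \<longleftrightarrow> walk_from (parcs H) q ps"
    if "q \<in> pverts H" "set ps \<subseteq> pverts H" for q ps
    using that by (induction ps arbitrary: q) (auto simp: e)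
  have closed: "map f ps \<in> closed_walks K n (f p) \<longleftrightarrow> ps \<in> closed_walks H n p"
    if ps: "set ps \<subseteq> pverts H" for ps
  proof -
    have "last (p # ps) \<in> pverts H" using ps p by (auto simp: last_in_set subset_iff)
    moreover have "last (f p # map f ps) = f (last (p # ps))" by (simp add: last_map)
    ultimately have "last (f p # map f ps) = f p \<longleftrightarrow> last (p # ps) = p"
      using p by (simp add: inj_on_eq_iff[OF inj] del: last.simps)
    then show ?thesis using walk[OF p ps] by (simp add: closed_walks_def del: last.simps)
  qed
  have "bij_betw (map f) (closed_walks H n p) (closed_walks K n (f p))"
  proof (rule bij_betw_imageI)
    have "closed_walks H n p \<subseteq> lists (pverts H)"
      using walk_from_in_verts[OF H] by (auto simp: closed_walks_def)
    then show "inj_on (map f) (closed_walks H n p)"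
      using inj_on_subset inj_on_mapI inj_on_map_lists[OF inj] by blast
    show "map f ` closed_walks H n p = closed_walks K n (f p)"
    proof (intro equalityI subsetI)
      fix qs assume "qs \<in> map f ` closed_walks H n p"
      then show "qs \<in> closed_walks K n (f p)"
        using closed walk_from_in_verts[OF H] by (auto simp: closed_walks_def simp del: last.simps)
    next
      fix qs assume qs: "qs \<in> closed_walks K n (f p)"
      then have "qs \<in> lists (f ` pverts H)"
        using walk_from_in_verts[OF K] im by (auto simp: closed_walks_def)
      then obtain ps where "set ps \<subseteq> pverts H" "qs = map f ps"
        by (auto simp: lists_image)
      then show "qs \<in> map f ` closed_walks H n p" using closed qs by blast
    qed
  qed
  then show ?thesis by (rule bij_betw_same_card)
qed

lemma card_closed_walks_vertex_transitive:
  assumes "pair_wf_digraph H" "vertex_transitive H" "p \<in> pverts H" "q \<in> pverts H"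
  shows "card (closed_walks H n p) = card (closed_walks H n q)"
proof -
  obtain f where "graph_isomorphism H H f" "f p = q"
    using assms(2-4) unfolding vertex_transitive_def graph_automorphism_def by blast
  then show ?thesis using card_closed_walks_isomorphism[OF assms(1) assms(1) _ assms(3)] by blast
qed

section \<open>Cartesian products\<close>

lemma vertex_transitive_cartesian_product:
  assumes "vertex_transitive G" "vertex_transitive F"
  shows "vertex_transitive (cartesian_product G F)"
  unfolding vertex_transitive_def
proof (intro ballI)
  fix p q assume "p \<in> pverts (cartesian_product G F)" "q \<in> pverts (cartesian_product G F)"
  then obtain x v y w where pq: "p = (x, v)" "q = (y, w)" and
    "x \<in> pverts G" "y \<in> pverts G" "v \<in> pverts F" "w \<in> pverts F"
    by (auto simp: cartesian_product_def)
  then obtain f g where f: "graph_automorphism G f" "f x = y"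
    and g: "graph_automorphism F g" "g v = w"
    using assms unfolding vertex_transitive_def by meson
  have "graph_automorphism (cartesian_product G F) (map_prod f g)"
    using f(1) g(1)
    by (auto simp: graph_automorphism_def graph_isomorphism_def cartesian_product_def
        bij_betw_def inj_on_eq_iff intro!: map_prod_inj_on map_prod_surj_on)
  then show "\<exists>h. graph_automorphism (cartesian_product G F) h \<and> h p = q"
    using f(2) g(2) pq by (intro exI[of _ "map_prod f g"]) simp
qed

section \<open>Parallel transport along base walks\<close>

locale connection_on_bundle =
  G: pair_bidirected_digraph G + F: pair_bidirected_digraph F
  for G :: "'a pair_pre_digraph" and F :: "'b pair_pre_digraph" +
  fixes \<phi> :: "'a \<Rightarrow> 'a \<Rightarrow> 'b \<Rightarrow> 'b"
  assumes connection: "is_connection G F \<phi>"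
begin

abbreviation twisted :: "('a \<times> 'b) pair_pre_digraph" where
  "twisted \<equiv> graph_bundle G \<phi> F"

abbreviation product :: "('a \<times> 'b) pair_pre_digraph" where
  "product \<equiv> cartesian_product G F"

text \<open>
  Transport from the fibre over \<^term>\<open>y\<close> to the fibre over \<^term>\<open>x\<close>. The projection of a walk
  in the bundle stands still at vertical steps, so the case of equal base points is included.
\<close>

definition step_back :: "'a \<Rightarrow> 'a \<Rightarrow> 'b \<Rightarrow> 'b" where
  "step_back x y = (if y = x then id else \<phi> x y)"

primrec holonomy :: "'a \<Rightarrow> 'a list \<Rightarrow> 'b \<Rightarrow> 'b" where
  "holonomy x [] = id"
| "holonomy x (y # ys) = step_back x y \<circ> holonomy y ys"

lemma wf_bundle: "pair_wf_digraph twisted"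
  using pair_bidirected_digraph_graph_bundle[OF _ _ connection]
    G.pair_bidirected_digraph_axioms F.pair_bidirected_digraph_axioms
  by (simp add: pair_bidirected_digraph_def pair_sym_digraph_def)

lemma wf_product: "pair_wf_digraph product"
  by unfold_locales (auto simp: cartesian_product_def)

lemma arc_sym: "(x, y) \<in> parcs G \<Longrightarrow> (y, x) \<in> parcs G"
  using G.pair_sym_arcs by (auto simp: symmetric_def dest: symD)

lemma arc_neq: "(x, y) \<in> parcs G \<Longrightarrow> x \<noteq> y"
  using G.pair_no_loops by fastforce

lemma automorphism_connection: "(x, y) \<in> parcs G \<Longrightarrow> graph_automorphism F (\<phi> y x)"
  using connection by (auto simp: is_connection_def)

lemma connection_inverse:
  assumes "(x, y) \<in> parcs G" "v \<in> pverts F"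
  shows "\<phi> x y (\<phi> y x v) = v"
proof -
  have b: "bij_betw (\<phi> y x) (pverts F) (pverts F)"
    using automorphism_connection[OF assms(1)]
    by (simp add: graph_automorphism_def graph_isomorphism_def)
  then have "\<phi> y x v \<in> pverts F" using assms by (auto dest: bij_betwE)
  then have "\<phi> x y (\<phi> y x v) = the_inv_into (pverts F) (\<phi> y x) (\<phi> y x v)"
    using connection assms by (auto simp: is_connection_def)
  then show ?thesis using b assms by (simp add: bij_betw_def the_inv_into_f_f)
qed

lemma automorphism_comp:
  assumes "graph_automorphism F f" "graph_automorphism F g"
  shows "graph_automorphism F (f \<circ> g)"
proof -
  have "g v \<in> pverts F" if "v \<in> pverts F" for v
    using assms(2) that by (auto simp: graph_automorphism_def graph_isomorphism_def bij_betwE)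
  then show ?thesis
    using assms bij_betw_trans[of g "pverts F" "pverts F" f "pverts F"]
    by (simp add: graph_automorphism_def graph_isomorphism_def)
qed

lemma automorphism_in_verts: "graph_automorphism F f \<Longrightarrow> v \<in> pverts F \<Longrightarrow> f v \<in> pverts F"
  by (auto simp: graph_automorphism_def graph_isomorphism_def bij_betwE)

lemma automorphism_eq_iff:
  "graph_automorphism F f \<Longrightarrow> v \<in> pverts F \<Longrightarrow> w \<in> pverts F \<Longrightarrow> f v = f w \<longleftrightarrow> v = w"
  by (auto simp: graph_automorphism_def graph_isomorphism_def bij_betw_def inj_on_eq_iff)

lemma automorphism_surj:
  assumes "graph_automorphism F f" "w \<in> pverts F"
  obtains v where "v \<in> pverts F" "f v = w"
proof -
  have "w \<in> f ` pverts F"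
    using assms by (simp add: graph_automorphism_def graph_isomorphism_def bij_betw_def)
  then show thesis using that by blast
qed

lemma automorphism_id: "graph_automorphism F id"
  by (auto simp: graph_automorphism_def graph_isomorphism_def)

lemma automorphism_step_back: "(x, y) \<in> (parcs G)\<^sup>= \<Longrightarrow> graph_automorphism F (step_back x y)"
  using automorphism_connection[OF arc_sym] automorphism_id by (auto simp: step_back_def)

lemma automorphism_holonomy:
  "walk_from ((parcs G)\<^sup>=) x ys \<Longrightarrow> graph_automorphism F (holonomy x ys)"
  by (induction ys arbitrary: x)
    (auto simp del: Un_iff intro!: automorphism_id automorphism_comp automorphism_step_back)

lemma walk_from_mono: "walk_from E x ys \<Longrightarrow> E \<subseteq> E' \<Longrightarrow> walk_from E' x ys"
  by (induction ys arbitrary: x) auto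

lemma automorphism_holonomy_walk:
  "walk_from (parcs G) x ys \<Longrightarrow> graph_automorphism F (holonomy x ys)"
  by (rule automorphism_holonomy, erule walk_from_mono) blast

lemma holonomy_append: "holonomy x (ys @ zs) = holonomy x ys \<circ> holonomy (last (x # ys)) zs"
  by (induction ys arbitrary: x) (auto simp: comp_assoc)

text \<open>
  A stationary step contributes the identity to the holonomy, so dropping it shortens the walk
  without changing its end or its holonomy. This is what makes a vertical step of a bundle walk
  count against the minimal length of a base walk with non-trivial holonomy.
\<close>

lemma remove_stutters:
  assumes "walk_from ((parcs G)\<^sup>=) x ys"
  shows "walk_from (parcs G) x ys \<or>
    (\<exists>zs. walk_from (parcs G) x zs \<and> length zs < length ys \<and>
      last (x # zs) = last (x # ys) \<and> holonomy x zs = holonomy x ys)"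
  using assms
proof (induction ys arbitrary: x)
  case (Cons y ys)
  have IH: "walk_from (parcs G) y ys \<or>
    (\<exists>zs. walk_from (parcs G) y zs \<and> length zs < length ys \<and>
      last (y # zs) = last (y # ys) \<and> holonomy y zs = holonomy y ys)"
    using Cons by simp
  show ?case
  proof (cases "y = x")
    case True
    then have "step_back x y = id" by (simp add: step_back_def)
    with IH True show ?thesis
      by (metis (no_types, lifting) holonomy.simps(2) id_comp last_ConsR length_Cons less_Suc_eq
          list.distinct(1))
  next
    case False
    with Cons.prems have e: "(x, y) \<in> parcs G" by auto
    from IH show ?thesis
    proof (elim disjE exE)
      fix zs assume "walk_from (parcs G) y zs \<and> length zs < length ys \<and>
        last (y # zs) = last (y # ys) \<and> holonomy y zs = holonomy y ys"
      then have "walk_from (parcs G) x (y # zs) \<and> length (y # zs) < length (y # ys) \<and>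
        last (x # y # zs) = last (x # y # ys) \<and> holonomy x (y # zs) = holonomy x (y # ys)"
        using e by simp
      then show ?thesis by blast
    qed (use e in simp)
  qed
qed simp

section \<open>Straightening walks of the bundle\<close>

text \<open>
  The parameter \<^term>\<open>b\<close> accumulates the transport from the fibre over the current base point
  \<^term>\<open>x\<close> back to the fibre in which the walk started, where all fibre coordinates are
  recorded. A horizontal step of the bundle then leaves the recorded coordinate unchanged, which is
  what a horizontal step does in the product.
\<close>

fun straighten :: "('b \<Rightarrow> 'b) \<Rightarrow> 'a \<Rightarrow> ('a \<times> 'b) list \<Rightarrow> ('a \<times> 'b) list" where
  "straighten b x [] = []"
| "straighten b x ((y, w) # ps) = (y, b (step_back x y w)) # straighten (b \<circ> step_back x y) y ps"

lemma bundle_arc: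
  "((x, v), (y, w)) \<in> parcs twisted \<longleftrightarrow>
    x \<in> pverts G \<and> y \<in> pverts G \<and> v \<in> pverts F \<and> w \<in> pverts F \<and>
    (x = y \<and> (v, w) \<in> parcs F \<or> (x, y) \<in> parcs G \<and> w = \<phi> y x v)"
  by (simp add: graph_bundle_def)

lemma product_arc:
  "((x, v), (y, w)) \<in> parcs product \<longleftrightarrow>
    x \<in> pverts G \<and> y \<in> pverts G \<and> v \<in> pverts F \<and> w \<in> pverts F \<and>
    (x = y \<and> (v, w) \<in> parcs F \<or> (x, y) \<in> parcs G \<and> v = w)"
  by (simp add: cartesian_product_def)

lemma horizontal_arc_iff:
  assumes "(x, y) \<in> parcs G" "v \<in> pverts F" "w \<in> pverts F"
  shows "w = \<phi> y x v \<longleftrightarrow> v = \<phi> x y w"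
  using connection_inverse[OF assms(1,2)] connection_inverse[OF arc_sym[OF assms(1)] assms(3)]
  by auto

text \<open>
  Vertical steps are preserved because \<^term>\<open>b\<close> is an automorphism of the fibre; for a horizontal
  step, \<^term>\<open>w\<close> is the transport of \<^term>\<open>v\<close> exactly if transporting it back gives
  \<^term>\<open>v\<close>.
\<close>

lemma straighten_arc_iff:
  assumes b: "graph_automorphism F b" and v: "v \<in> pverts F" and w: "w \<in> pverts F"
    and xy: "(x, y) \<in> (parcs G)\<^sup>="
  shows "((x, v), (y, w)) \<in> parcs twisted \<longleftrightarrow> ((x, b v), (y, b (step_back x y w))) \<in> parcs product"
proof (cases "x = y")
  case True
  have "(v, w) \<in> parcs F \<longleftrightarrow> (b v, b w) \<in> parcs F"
    using b v w by (auto simp: graph_automorphism_def graph_isomorphism_def)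
  then show ?thesis
    using True b v w automorphism_in_verts arc_neq
    by (auto simp: bundle_arc product_arc step_back_def)
next
  case False
  then have e: "(x, y) \<in> parcs G" and sb: "step_back x y = \<phi> x y" using xy by (auto simp: step_back_def)
  have a: "\<phi> x y w \<in> pverts F"
    using automorphism_in_verts automorphism_connection arc_sym e w by blast
  then have "w = \<phi> y x v \<longleftrightarrow> b v = b (\<phi> x y w)"
    using horizontal_arc_iff[OF e v w] automorphism_eq_iff[OF b v a] by simp
  then show ?thesis
    using False e b v w a automorphism_in_verts
    by (auto simp: bundle_arc product_arc sb)
qed

lemma bundle_arc_base: "(p, q) \<in> parcs twisted \<Longrightarrow> (fst p, fst q) \<in> (parcs G)\<^sup>="
  by (auto simp: graph_bundle_def)

lemma product_arc_base: "(p, q) \<in> parcs product \<Longrightarrow> (fst p, fst q) \<in> (parcs G)\<^sup>="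
  by (auto simp: cartesian_product_def)

lemma bundle_walk_base:
  "walk_from (parcs twisted) p ps \<Longrightarrow> walk_from ((parcs G)\<^sup>=) (fst p) (map fst ps)"
  by (induction ps arbitrary: p) (auto simp del: Un_iff dest: bundle_arc_base)

lemma length_straighten: "length (straighten b x ps) = length ps"
  by (induction b x ps rule: straighten.induct) (auto simp: comp_def)

text \<open>
  The holonomy of the base walk measures how far the endpoint is moved, and hence decides which
  closed walks stay closed.
\<close>

lemma last_straighten:
  "last ((x, b v) # straighten b x ps) =
    (fst (last ((x, v) # ps)), b (holonomy x (map fst ps) (snd (last ((x, v) # ps)))))"
proof (induction b x ps arbitrary: v rule: straighten.induct)
  case (2 b x y w ps)
  from 2[of w] show ?case by (simp add: comp_def)
qed simp

lemma walk_from_straighten: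
  assumes "walk_from (parcs twisted) (x, v) ps" "graph_automorphism F b"
  shows "walk_from (parcs product) (x, b v) (straighten b x ps)"
  using assms
proof (induction b x ps arbitrary: v rule: straighten.induct)
  case (2 b x y w ps)
  then have e: "((x, v), (y, w)) \<in> parcs twisted" and ws: "walk_from (parcs twisted) (y, w) ps"
    by simp_all
  have xy: "(x, y) \<in> (parcs G)\<^sup>=" using bundle_arc_base[OF e] by simp
  then have c: "graph_automorphism F (b \<circ> step_back x y)"
    using 2(3) automorphism_step_back automorphism_comp by blast
  have "v \<in> pverts F" "w \<in> pverts F" using e by (simp_all add: bundle_arc)
  then have "((x, b v), (y, b (step_back x y w))) \<in> parcs product"
    using straighten_arc_iff[OF 2(3) _ _ xy] e by blast
  then show ?case using 2(1)[OF ws c] by (simp add: comp_def)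
qed simp

lemma straighten_inj:
  assumes "walk_from (parcs twisted) (x, v) ps" "walk_from (parcs twisted) (x, v) qs"
    "graph_automorphism F b" "straighten b x ps = straighten b x qs"
  shows "ps = qs"
  using assms
proof (induction ps arbitrary: qs b x v)
  case Nil
  then show ?case by (cases qs) auto
next
  case (Cons p ps)
  obtain y w where p: "p = (y, w)" by fastforce
  obtain q qs' where qs: "qs = q # qs'" using Cons.prems(4) p by (cases qs) auto
  obtain w' where q: "q = (y, w')" using Cons.prems(4) p qs by (cases q) auto
  have e: "((x, v), (y, w)) \<in> parcs twisted" "((x, v), (y, w')) \<in> parcs twisted"
    using Cons.prems p q qs by auto
  have "(x, y) \<in> (parcs G)\<^sup>=" using bundle_arc_base[OF e(1)] by simp
  then have c: "graph_automorphism F (b \<circ> step_back x y)"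
    using Cons.prems(3) automorphism_step_back automorphism_comp by blast
  have "w = w'"
    using automorphism_eq_iff[OF c, of w w'] e Cons.prems(4) p q qs by (simp add: bundle_arc)
  moreover have "ps = qs'"
    by (rule Cons.IH[OF _ _ c, of y w]) (use Cons.prems p q qs \<open>w = w'\<close> in \<open>auto simp: comp_def\<close>)
  ultimately show ?case using p q qs by simp
qed

lemma straighten_surj:
  assumes "walk_from (parcs product) (x, b v) qs" "graph_automorphism F b" "v \<in> pverts F"
  obtains ps where "walk_from (parcs twisted) (x, v) ps" "straighten b x ps = qs"
  using assms
proof (induction qs arbitrary: b x v thesis)
  case Nil
  show ?case by (rule Nil(1)[of "[]"]) auto
next
  case (Cons q qs)
  obtain y u where q: "q = (y, u)" by fastforce
  have e: "((x, b v), (y, u)) \<in> parcs product" and ws: "walk_from (parcs product) (y, u) qs"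
    using Cons.prems q by auto
  have xy: "(x, y) \<in> (parcs G)\<^sup>=" using product_arc_base[OF e] by simp
  then have c: "graph_automorphism F (b \<circ> step_back x y)"
    using Cons.prems(3) automorphism_step_back automorphism_comp by blast
  obtain w where w: "w \<in> pverts F" "(b \<circ> step_back x y) w = u"
    using automorphism_surj[OF c] e by (auto simp: product_arc)
  obtain ps where ps: "walk_from (parcs twisted) (y, w) ps" "straighten (b \<circ> step_back x y) y ps = qs"
    using Cons.IH[OF _ _ c w(1)] ws w(2) by blast
  have "((x, v), (y, w)) \<in> parcs twisted"
    using straighten_arc_iff[OF Cons.prems(3,4) w(1) xy] e w(2) by simp
  then show ?case using ps w(2) q by (intro Cons.prems(1)[of "(y, w) # ps"]) auto
qed

lemma straighten_closed_walk:
  assumes "ps \<in> closed_walks twisted n (x, v)" "holonomy x (map fst ps) v = v"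
  shows "straighten id x ps \<in> closed_walks product n (x, v)"
  using assms walk_from_straighten[of x v ps id] last_straighten[of x id v ps] automorphism_id
  by (simp add: closed_walks_def length_straighten del: last.simps)

lemma straighten_inj_on: "inj_on (straighten id x) (closed_walks twisted n (x, v))"
proof (rule inj_onI)
  fix ps qs
  assume "ps \<in> closed_walks twisted n (x, v)" "qs \<in> closed_walks twisted n (x, v)"
    and "straighten id x ps = straighten id x qs"
  then show "ps = qs"
    using straighten_inj[OF _ _ automorphism_id] by (auto simp: closed_walks_def)
qed

text \<open>
  A bundle walk whose projection never stands still has horizontal steps only, so it is the
  parallel lift of its projection and transporting its end back recovers its start.
\<close>

lemma holonomy_horizontal_walk:
  assumes "walk_from (parcs twisted) (x, v) ps" "walk_from (parcs G) x (map fst ps)"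
  shows "holonomy x (map fst ps) (snd (last ((x, v) # ps))) = v"
  using assms
proof (induction ps arbitrary: x v)
  case (Cons p ps)
  obtain y w where p: "p = (y, w)" by fastforce
  have e: "(x, y) \<in> parcs G" "((x, v), (y, w)) \<in> parcs twisted" using Cons.prems p by auto
  then have "step_back x y w = v"
    using arc_neq connection_inverse by (auto simp: bundle_arc step_back_def)
  moreover have "holonomy y (map fst ps) (snd (last ((y, w) # ps))) = w"
    using Cons p by auto
  ultimately show ?case using p by simp
qed simp

lemma constant_walk_product:
  "walk_from (parcs G) x ys \<Longrightarrow> v \<in> pverts F \<Longrightarrow>
    walk_from (parcs product) (x, v) (map (\<lambda>y. (y, v)) ys)"
  by (induction ys arbitrary: x)
    (auto simp: product_arc dest: G.arc_fst_in_verts G.arc_snd_in_verts)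

lemma map_fst_straighten: "map fst (straighten b x ps) = map fst ps"
  by (induction b x ps rule: straighten.induct) (auto simp: comp_def)

lemma finite_closed_walks_product:
  assumes "locally_finite G" "locally_finite F"
  shows "finite (closed_walks product n p)"
proof -
  have "finite (parcs product `` {q})" for q
  proof -
    obtain x v where q: "q = (x, v)" by fastforce
    have "parcs product `` {q} \<subseteq> {x} \<times> parcs F `` {v} \<union> parcs G `` {x} \<times> {v}"
      by (auto simp: q cartesian_product_def)
    moreover have "finite (parcs F `` {v})" "finite (parcs G `` {x})"
      using assms locally_finite_finite_neighbours[OF F.pair_wf_digraph_axioms]
        locally_finite_finite_neighbours[OF G.pair_wf_digraph_axioms] by simp_all
    ultimately show ?thesis
      by (elim finite_subset) simp
  qed
  then have "finite {ps. length ps = n \<and> walk_from (parcs product) p ps}"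
    by (rule finite_walks_from)
  then show ?thesis by (rule rev_finite_subset) (auto simp: closed_walks_def)
qed

text \<open>
  The deficit occurs at the least length of a closed base walk whose holonomy moves \<^term>\<open>v\<close>.
  Longer closed bundle walks may combine such a base walk with vertical steps that undo its effect,
  and straightening does not keep those closed.
\<close>

lemma holonomy_deficit:
  assumes lf: "locally_finite G" "locally_finite F"
    and v: "v \<in> pverts F"
    and ys: "walk_from (parcs G) x ys" "last (x # ys) = x" "holonomy x ys v \<noteq> v"
  obtains n where "card (closed_walks twisted n (x, v)) < card (closed_walks product n (x, v))"
proof -
  define bad where "bad ys \<longleftrightarrow>
    walk_from (parcs G) x ys \<and> last (x # ys) = x \<and> holonomy x ys v \<noteq> v" for ys
  obtain zs where zs: "bad zs" and min: "\<And>ys. bad ys \<Longrightarrow> length zs \<le> length ys"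
    using ys ex_has_least_nat[of bad _ length] unfolding bad_def by blast
  let ?n = "length zs"
  have triv: "holonomy x (map fst ps) v = v" if ps: "ps \<in> closed_walks twisted ?n (x, v)" for ps
  proof -
    have w: "walk_from (parcs twisted) (x, v) ps" and len: "length ps = ?n"
      and l: "last ((x, v) # ps) = (x, v)"
      using ps by (auto simp: closed_walks_def simp del: last.simps)
    have base: "last (x # map fst ps) = x"
      using l by (cases ps) (auto simp: last_map)
    consider "walk_from (parcs G) x (map fst ps)"
      | us where "walk_from (parcs G) x us" "length us < ?n" "last (x # us) = x"
        "holonomy x us = holonomy x (map fst ps)"
      using remove_stutters[OF bundle_walk_base[OF w]] len base by (auto simp del: last.simps)
    then show ?thesis
    proof cases
      case 1
      from holonomy_horizontal_walk[OF w this] l show ?thesis by (simp del: last.simps)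
    next
      case 2
      then have "\<not> bad us" using min[of us] by auto
      with 2 show ?thesis by (auto simp: bad_def)
    qed
  qed
  let ?c = "map (\<lambda>y. (y, v)) zs"
  have c: "?c \<in> closed_walks product ?n (x, v)"
    using zs constant_walk_product[OF _ v] by (auto simp: closed_walks_def bad_def last_map)
  (* A preimage would be a closed bundle walk over zs, but the holonomy along zs moves v. *)
  have "?c \<notin> straighten id x ` closed_walks twisted ?n (x, v)"
  proof
    assume "?c \<in> straighten id x ` closed_walks twisted ?n (x, v)"
    then obtain ps where ps: "ps \<in> closed_walks twisted ?n (x, v)" "straighten id x ps = ?c"
      by auto
    have "map fst ps = zs" using map_fst_straighten[of id x ps] ps(2) by (simp add: comp_def)
    then show False using triv[OF ps(1)] zs by (simp add: bad_def)
  qed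
  then have "straighten id x ` closed_walks twisted ?n (x, v) \<subset> closed_walks product ?n (x, v)"
    using c straighten_closed_walk triv by blast
  then have "card (straighten id x ` closed_walks twisted ?n (x, v))
      < card (closed_walks product ?n (x, v))"
    using finite_closed_walks_product[OF lf] psubset_card_mono by blast
  then show thesis using that card_image[OF straighten_inj_on] by metis
qed

lemma holonomy_fixed_vertex:
  assumes z: "\<And>x y. (x, y) \<in> parcs G \<Longrightarrow> \<phi> y x z = z"
  shows "walk_from ((parcs G)\<^sup>=) x ys \<Longrightarrow> holonomy x ys z = z"
  using z arc_sym by (induction ys arbitrary: x) (auto simp: step_back_def)

text \<open>
  No base walk moves \<^term>\<open>z\<close>, so a bundle walk from \<^term>\<open>(x, z)\<close> closes up exactly if its
  straightening does.
\<close>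

lemma card_closed_walks_null:
  assumes z: "\<And>x y. (x, y) \<in> parcs G \<Longrightarrow> \<phi> y x z = z" and zF: "z \<in> pverts F"
  shows "card (closed_walks twisted n (x, z)) = card (closed_walks product n (x, z))"
proof -
  have hol: "holonomy x (map fst ps) z = z" if "walk_from (parcs twisted) (x, z) ps" for ps
    using bundle_walk_base[OF that] holonomy_fixed_vertex[OF z] by simp
  have "straighten id x ` closed_walks twisted n (x, z) = closed_walks product n (x, z)"
  proof (intro equalityI subsetI)
    fix qs assume "qs \<in> straighten id x ` closed_walks twisted n (x, z)"
    then obtain ps where ps: "ps \<in> closed_walks twisted n (x, z)" "qs = straighten id x ps"
      by blast
    then have "walk_from (parcs twisted) (x, z) ps" by (simp add: closed_walks_def)
    with ps show "qs \<in> closed_walks product n (x, z)"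
      using straighten_closed_walk hol by blast
  next
    fix qs assume qs: "qs \<in> closed_walks product n (x, z)"
    then obtain ps where ps: "walk_from (parcs twisted) (x, z) ps" "straighten id x ps = qs"
      using straighten_surj[OF _ automorphism_id zF, of x qs] by (auto simp: closed_walks_def)
    let ?q = "last ((x, z) # ps)"
    have l: "(fst ?q, holonomy x (map fst ps) (snd ?q)) = (x, z)"
      using last_straighten[of x id z ps] qs ps(2) by (simp add: closed_walks_def del: last.simps)
    have "snd ?q \<in> pverts F"
    proof (cases "ps = []")
      case False
      then have "?q \<in> set ps" by simp
      then have "?q \<in> pverts twisted" using walk_from_in_verts[OF wf_bundle ps(1)] by blast
      then show ?thesis by (auto simp: graph_bundle_def mem_Times_iff simp del: last.simps)
    qed (simp add: zF)
    then have "snd ?q = z"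
      using l hol[OF ps(1)] automorphism_eq_iff[OF automorphism_holonomy[OF bundle_walk_base[OF ps(1)]]] zF
      by (metis fst_conv snd_conv)
    then have "?q = (x, z)" using l by (metis fst_conv prod.collapse)
    then have "ps \<in> closed_walks twisted n (x, z)"
      using qs ps length_straighten[of id x ps] by (simp add: closed_walks_def del: last.simps)
    then show "qs \<in> straighten id x ` closed_walks twisted n (x, z)" using ps(2) by blast
  qed
  then show ?thesis using card_image[OF straighten_inj_on] by metis
qed

section \<open>Connections without holonomy\<close>

lemma walk_exists:
  assumes "Digraph_Component.connected (with_proj G)" "x \<in> pverts G" "y \<in> pverts G"
  obtains ys where "walk_from (parcs G) x ys" "last (x # ys) = y"
proof -
  have "x \<rightarrow>\<^sup>*\<^bsub>with_proj G\<^esub> y"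
    using G.symmetric_connected_imp_strongly_connected[OF G.pair_sym_arcs assms(1)] assms(2,3)
    by (auto simp: strongly_connected_def)
  then have "\<exists>ys. walk_from (parcs G) x ys \<and> last (x # ys) = y"
  proof (induction rule: G.reachable_induct)
    case base
    show ?case by (intro exI[of _ "[]"]) simp
  next
    case (step y z)
    then obtain ys where "walk_from (parcs G) x ys" "last (x # ys) = y" by blast
    with step.hyps(2) show ?case
      by (intro exI[of _ "ys @ [z]"]) (auto simp: walk_from_append)
  qed
  then show thesis using that by blast
qed

text \<open>
  Transporting every fibre back to the fibre over \<^term>\<open>x0\<close> along a chosen walk is an isomorphism
  onto the product: horizontal steps become steps with constant fibre coordinate because transport
  to \<^term>\<open>x0\<close> is independent of the walk.
\<close>

lemma trivial_connection_if_no_holonomy: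
  assumes conn: "Digraph_Component.connected (with_proj G)" and x0: "x0 \<in> pverts G"
    and triv: "\<And>ys v. walk_from (parcs G) x0 ys \<Longrightarrow> last (x0 # ys) = x0 \<Longrightarrow> v \<in> pverts F \<Longrightarrow>
      holonomy x0 ys v = v"
  shows "trivial_connection G F \<phi>"
proof -
  have indep: "holonomy x0 ys w = holonomy x0 zs w"
    if ys: "walk_from (parcs G) x0 ys" "last (x0 # ys) = y"
      and zs: "walk_from (parcs G) x0 zs" "last (x0 # zs) = y"
      and y: "y \<in> pverts G" and w: "w \<in> pverts F" for ys zs y w
  proof -
    (* Both walks are closed up by the same return walk ds, whose transport is then cancelled. *)
    obtain ds where ds: "walk_from (parcs G) y ds" "last (y # ds) = x0"
      using walk_exists[OF conn y x0] by blast
    obtain u where u: "u \<in> pverts F" "holonomy y ds u = w"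
      using automorphism_surj[OF automorphism_holonomy_walk[OF ds(1)] w] by blast
    have close: "holonomy x0 us w = u" if "walk_from (parcs G) x0 us" "last (x0 # us) = y" for us
    proof -
      have "last (x0 # us @ ds) = x0" using that(2) ds(2) by (auto split: if_splits)
      then have "holonomy x0 (us @ ds) u = u"
        using triv[of "us @ ds" u] that ds u(1) by (auto simp: walk_from_append simp del: last.simps)
      then show ?thesis using that(2) u(2) by (simp add: holonomy_append del: last.simps)
    qed
    show ?thesis using close ys zs by simp
  qed
  obtain \<gamma> where \<gamma>: "\<And>x. x \<in> pverts G \<Longrightarrow> walk_from (parcs G) x0 (\<gamma> x) \<and> last (x0 # \<gamma> x) = x"
  proof -
    have "\<forall>x\<in>pverts G. \<exists>ys. walk_from (parcs G) x0 ys \<and> last (x0 # ys) = x"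
      using walk_exists[OF conn x0] by blast
    from bchoice[OF this] show thesis using that by blast
  qed
  define h where "h x = holonomy x0 (\<gamma> x)" for x
  have aut: "graph_automorphism F (h x)" if "x \<in> pverts G" for x
    using \<gamma>[OF that] automorphism_holonomy_walk by (simp add: h_def)
  have step: "h y w = h x (\<phi> x y w)" if e: "(x, y) \<in> parcs G" and w: "w \<in> pverts F" for x y w
  proof -
    have xy: "x \<in> pverts G" "y \<in> pverts G" using e by (auto dest: G.arc_fst_in_verts G.arc_snd_in_verts)
    have "holonomy x0 (\<gamma> y) w = holonomy x0 (\<gamma> x @ [y]) w"
      by (rule indep[OF _ _ _ _ xy(2) w]) (use \<gamma> xy e in \<open>auto simp: walk_from_append\<close>)
    then show ?thesis
      using \<gamma>[OF xy(1)] arc_neq[OF e] by (auto simp: h_def holonomy_append step_back_def)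
  qed
  define f where "f p = (fst p, h (fst p) (snd p))" for p
  have "bij_betw f (pverts G \<times> pverts F) (pverts G \<times> pverts F)"
  proof (rule bij_betw_imageI)
    show "inj_on f (pverts G \<times> pverts F)"
      using automorphism_eq_iff[OF aut] by (auto simp: f_def inj_on_def)
    show "f ` (pverts G \<times> pverts F) = pverts G \<times> pverts F"
    proof (intro equalityI subsetI)
      fix p assume "p \<in> f ` (pverts G \<times> pverts F)"
      then show "p \<in> pverts G \<times> pverts F" using aut automorphism_in_verts by (auto simp: f_def)
    next
      fix p assume "p \<in> pverts G \<times> pverts F"
      then obtain x w where p: "p = (x, w)" "x \<in> pverts G" "w \<in> pverts F" by auto
      obtain v where "v \<in> pverts F" "h x v = w" using automorphism_surj[OF aut] p by blast
      then show "p \<in> f ` (pverts G \<times> pverts F)" using p by (intro image_eqI[of _ _ "(x, v)"]) (auto simp: f_def)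
    qed
  qed
  moreover have "((x, v), (y, w)) \<in> parcs twisted \<longleftrightarrow> (f (x, v), f (y, w)) \<in> parcs product"
    if "x \<in> pverts G" "y \<in> pverts G" "v \<in> pverts F" "w \<in> pverts F" for x y v w
  proof -
    have "(v, w) \<in> parcs F \<longleftrightarrow> (h x v, h x w) \<in> parcs F"
      using aut that by (auto simp: graph_automorphism_def graph_isomorphism_def)
    moreover have "w = \<phi> y x v \<longleftrightarrow> h x v = h y w" if e: "(x, y) \<in> parcs G"
    proof -
      have "\<phi> x y w \<in> pverts F"
        using automorphism_in_verts automorphism_connection arc_sym e \<open>w \<in> _\<close> by blast
      then show ?thesis
        using horizontal_arc_iff[OF e] step[OF e] automorphism_eq_iff[OF aut]
          \<open>x \<in> _\<close> \<open>v \<in> _\<close> \<open>w \<in> _\<close> by metis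
    qed
    ultimately show ?thesis
      using that automorphism_in_verts[OF aut] by (auto simp: bundle_arc product_arc f_def)
  qed
  ultimately have "graph_isomorphism twisted product f"
    by (auto simp: graph_isomorphism_def graph_bundle_def[of G \<phi> F] cartesian_product_def)
  then show ?thesis
    unfolding trivial_connection_def equivalent_connections_def graph_bundle_identity_connection
    by (intro exI[of _ f]) (simp add: f_def)
qed

end

section \<open>Comparison with the Cartesian product\<close>

theorem theorem2:
  fixes G :: "'a pair_pre_digraph" and F :: "'b pair_pre_digraph"
    and \<phi> :: "'a \<Rightarrow> 'a \<Rightarrow> 'b \<Rightarrow> 'b"
  assumes "pair_bidirected_digraph G" "locally_finite G" "Digraph_Component.connected (with_proj G)"
    and "pair_bidirected_digraph F" "locally_finite F" "Digraph_Component.connected (with_proj F)"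
    and "vertex_transitive G" "vertex_transitive F"
    and "is_connection G F \<phi>"
    and "\<not> trivial_connection G F \<phi>"
  shows "\<not> digraph_iso (with_proj (graph_bundle G \<phi> F)) (with_proj (cartesian_product G F)) \<and>
    (discrete_vector_bundle G \<phi> F \<longrightarrow> \<not> vertex_transitive (graph_bundle G \<phi> F))"
proof -
  interpret connection_on_bundle G F \<phi>
    using assms by (simp add: connection_on_bundle_def connection_on_bundle_axioms_def)
  obtain x0 where x0: "x0 \<in> pverts G"
    using assms(3) by (auto simp: connected_conv)
  obtain ys v where ys: "walk_from (parcs G) x0 ys" "last (x0 # ys) = x0" "holonomy x0 ys v \<noteq> v"
    and v: "v \<in> pverts F"
    using trivial_connection_if_no_holonomy[OF assms(3) x0] assms(10) by blast
  obtain n where n: "card (closed_walks twisted n (x0, v)) < card (closed_walks product n (x0, v))"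
    using holonomy_deficit[OF assms(2,5) v ys] .
  have P: "pverts product = pverts G \<times> pverts F" and B: "pverts twisted = pverts G \<times> pverts F"
    by (simp_all add: cartesian_product_def graph_bundle_def)
  have trans: "card (closed_walks product n p) = card (closed_walks product n q)"
    if "p \<in> pverts product" "q \<in> pverts product" for p q
    using card_closed_walks_vertex_transitive[OF wf_product] that
      vertex_transitive_cartesian_product[OF assms(7,8)] by blast
  have "\<not> digraph_iso (with_proj twisted) (with_proj product)"
  proof
    assume "digraph_iso (with_proj twisted) (with_proj product)"
    then obtain f where f: "graph_isomorphism twisted product f"
      using digraph_iso_iff_graph_isomorphism[OF wf_bundle wf_product] by blast
    have "f (x0, v) \<in> pverts product"
      using f x0 v B by (auto simp: graph_isomorphism_def dest!: bij_betwE)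
    then show False
      using n trans[of "f (x0, v)" "(x0, v)"] P x0 v B
        card_closed_walks_isomorphism[OF wf_bundle wf_product f, of "(x0, v)" n] by simp
  qed
  moreover have "\<not> vertex_transitive twisted" if dvb: "discrete_vector_bundle G \<phi> F"
  proof
    assume vt: "vertex_transitive twisted"
    obtain z where z: "z \<in> pverts F" and fixed: "\<forall>(x, y)\<in>parcs G. \<phi> y x z = z"
      using dvb unfolding discrete_vector_bundle_def by blast
    have "card (closed_walks twisted n (x0, v)) = card (closed_walks twisted n (x0, z))"
      using card_closed_walks_vertex_transitive[OF wf_bundle vt] B x0 v z by simp
    also have "\<dots> = card (closed_walks product n (x0, z))"
      using card_closed_walks_null[OF _ z] fixed by blast
    also have "\<dots> = card (closed_walks product n (x0, v))"
      using trans P x0 v z by simp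
    finally show False using n by simp
  qed
  ultimately show ?thesis by blast
qed

end
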